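(* Let $D$ be a skew field, $\sigma$ a ring automorphism of $D$, $\delta$ a $\sigma$-derivation of $D$, and let $f\in R=D[X;\sigma,\delta]$ be a bounded polynomial. Given a factorization $f^*=\pi_1\cdots\pi_s$ where $\pi_i$ is prime twosided for all $1\le i\le s$, one can compute $g_1,\dots,g_s\in R$ such that $f=g_1\cdots g_s$ and $g_i^*=\pi_i$ for all $1\le i\le s$ (in particular, such $g_1,\dots,g_s$ exist).
   Context: A $\sigma$-derivation is an additive map $\delta:D\to D$ with $\delta(ab)=\sigma(a)\delta(b)+\delta(a)b$. $R=D[X;\sigma,\delta]$ has left $D$-basis $\{X^n:n\ge0\}$ and $Xa=\sigma(a)X+\delta(a)$ for $a\in D$; it is a left and right principal ideal domain. A polynomial $\alpha$ is twosided if $R\alpha=\alpha R$; a twosided polynomial $\pi$ of positive degree is prime twosided if $R\pi$ is a maximal twosided ideal (equivalently $R/R\pi$ is simple Artinian). A bound $f^*$ of $f$ is a twosided polynomial with $Rf^*=f^*R=\operatorname{Ann}_R(R/Rf)$ (the largest twosided ideal contained in $Rf$), determined up to left multiplication by nonzero elements of $D$, and $f$ is bounded if $f^*\ne0$; equalities between bounds such as $g_i^*=\pi_i$ are up to such multiplication (i.e. $Rg_i^*=R\pi_i$). The arithmetic of $D$, $\sigma$, $\delta$ is assumed effective, so that Euclidean divisions and right greatest common divisors (generators of $Rf+Rg$) in $R$ are computable. *)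

theory Defs
  imports "HOL-Computational_Algebra.Polynomial" "HOL-Algebra.Ideal" "HOL-Library.Monad_Syntax"
begin

section \<open>The skew polynomial ring\<close>

definition ring_automorphism :: "('a::ring_1 \<Rightarrow> 'a) \<Rightarrow> bool" where
  "ring_automorphism \<sigma> \<longleftrightarrow> bij \<sigma> \<and> \<sigma> 1 = 1 \<and>
     (\<forall>a b. \<sigma> (a + b) = \<sigma> a + \<sigma> b) \<and> (\<forall>a b. \<sigma> (a * b) = \<sigma> a * \<sigma> b)"

definition skew_derivation :: "('a::ring_1 \<Rightarrow> 'a) \<Rightarrow> ('a \<Rightarrow> 'a) \<Rightarrow> bool" where
  "skew_derivation \<sigma> \<delta> \<longleftrightarrow>
     (\<forall>a b. \<delta> (a + b) = \<delta> a + \<delta> b) \<and> (\<forall>a b. \<delta> (a * b) = \<sigma> a * \<delta> b + \<delta> a * b)"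

text \<open>
  An element of \<open>D[X;\<sigma>,\<delta>]\<close> is represented by the \<open>'a poly\<close> of its left coefficients, that is,
  \<open>p\<close> stands for the sum of the \<open>coeff p i X^i\<close>.  Only the additive structure of \<open>'a poly\<close>
  is reused. Left multiplication by \<open>X\<close> follows from \<open>X b = \<sigma>(b) X + \<delta>(b)\<close>.
\<close>

definition X_mult :: "('a::division_ring \<Rightarrow> 'a) \<Rightarrow> ('a \<Rightarrow> 'a) \<Rightarrow> 'a poly \<Rightarrow> 'a poly" where
  "X_mult \<sigma> \<delta> q = pCons 0 (map_poly \<sigma> q) + map_poly \<delta> q"

definition skew_mult ::
  "('a::division_ring \<Rightarrow> 'a) \<Rightarrow> ('a \<Rightarrow> 'a) \<Rightarrow> 'a poly \<Rightarrow> 'a poly \<Rightarrow> 'a poly" where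
  "skew_mult \<sigma> \<delta> p q = (\<Sum>i\<le>degree p. map_poly (\<lambda>c. coeff p i * c) ((X_mult \<sigma> \<delta> ^^ i) q))"

lemma coeff_X_mult:
  assumes "ring_automorphism \<sigma>" "skew_derivation \<sigma> \<delta>"
  shows "coeff (X_mult \<sigma> \<delta> q) n = (case n of 0 \<Rightarrow> 0 | Suc m \<Rightarrow> \<sigma> (coeff q m)) + \<delta> (coeff q n)"
proof -
  have "\<sigma> (0 + 0) = \<sigma> 0 + \<sigma> 0" "\<delta> (0 + 0) = \<delta> 0 + \<delta> 0"
    using assms unfolding ring_automorphism_def skew_derivation_def by blast+
  hence "\<sigma> 0 = 0" "\<delta> 0 = 0" by simp_all
  thus ?thesis by (simp add: X_mult_def coeff_map_poly coeff_pCons split: nat.split)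
qed

lemma X_times_const:
  assumes "ring_automorphism \<sigma>" "skew_derivation \<sigma> \<delta>"
  shows "skew_mult \<sigma> \<delta> [:0, 1:] [:a:] = skew_mult \<sigma> \<delta> [:\<sigma> a:] [:0, 1:] + [:\<delta> a:]"
proof -
  have "\<sigma> (0 + 0) = \<sigma> 0 + \<sigma> 0" "\<delta> (0 + 0) = \<delta> 0 + \<delta> 0"
    using assms unfolding ring_automorphism_def skew_derivation_def by blast+
  hence "\<sigma> 0 = 0" "\<delta> 0 = 0" by simp_all
  thus ?thesis
    by (intro poly_eqI)
      (auto simp: skew_mult_def coeff_map_poly coeff_X_mult[OF assms] coeff_pCons split: nat.split)
qed

lemma const_times_X_power: "skew_mult \<sigma> \<delta> [:a:] (monom 1 n) = monom a n"
  by (auto simp: skew_mult_def poly_eq_iff coeff_map_poly)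

definition skew_poly_ring ::
  "('a::division_ring \<Rightarrow> 'a) \<Rightarrow> ('a \<Rightarrow> 'a) \<Rightarrow> 'a poly ring" where
  "skew_poly_ring \<sigma> \<delta> =
     \<lparr>carrier = UNIV, monoid.mult = skew_mult \<sigma> \<delta>, one = [:1:], ring.zero = 0, add = (+)\<rparr>"


section \<open>Twosided elements and bounds\<close>

text \<open>
  For a ring \<open>R\<close>, the left ideal \<open>R a\<close> is \<open>carrier R #>\<^bsub>R\<^esub> a\<close> and the right ideal \<open>a R\<close> is
  \<open>a <#\<^bsub>R\<^esub> carrier R\<close>.  The predicates \<^const>\<open>ideal\<close> and \<^const>\<open>maximalideal\<close> of the library
  refer to twosided ideals.
\<close>

definition twosided :: "('b, 'm) ring_scheme \<Rightarrow> 'b \<Rightarrow> bool" where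
  "twosided R a \<longleftrightarrow> a \<in> carrier R \<and> carrier R #>\<^bsub>R\<^esub> a = a <#\<^bsub>R\<^esub> carrier R"

definition prime_twosided :: "('a::zero poly, 'm) ring_scheme \<Rightarrow> 'a poly \<Rightarrow> bool" where
  "prime_twosided R p \<longleftrightarrow> twosided R p \<and> degree p > 0 \<and> maximalideal (carrier R #>\<^bsub>R\<^esub> p) R"

text \<open>The annihilator of the left module \<open>R / I\<close>; the element \<open>I +> a\<close> of \<open>R / I\<close> is multiplied
  by \<open>r\<close> to give \<open>I +> r a\<close>, and \<open>I\<close> itself is the zero coset.\<close>

definition ann_quotient :: "('b, 'm) ring_scheme \<Rightarrow> 'b set \<Rightarrow> 'b set" where
  "ann_quotient R I = {r \<in> carrier R. \<forall>a \<in> carrier R. I +>\<^bsub>R\<^esub> (r \<otimes>\<^bsub>R\<^esub> a) = I}"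

text \<open>Bounds are only determined up to left multiplication by units, so \<open>f\<^sup>* = b\<close> is rendered
  as a relation between \<open>f\<close> and \<open>b\<close>.\<close>

definition is_bound :: "('b, 'm) ring_scheme \<Rightarrow> 'b \<Rightarrow> 'b \<Rightarrow> bool" where
  "is_bound R f b \<longleftrightarrow>
     twosided R b \<and> carrier R #>\<^bsub>R\<^esub> b = ann_quotient R (carrier R #>\<^bsub>R\<^esub> f)"

definition bounded :: "('b, 'm) ring_scheme \<Rightarrow> 'b \<Rightarrow> bool" where
  "bounded R f \<longleftrightarrow> (\<exists>b. is_bound R f b \<and> b \<noteq> \<zero>\<^bsub>R\<^esub>)"

definition list_prod :: "('b, 'm) monoid_scheme \<Rightarrow> 'b list \<Rightarrow> 'b" where
  "list_prod R xs = foldr (\<lambda>x y. x \<otimes>\<^bsub>R\<^esub> y) xs \<one>\<^bsub>R\<^esub>"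


section \<open>Computations relative to the arithmetic of \<open>D\<close>, \<open>\<sigma>\<close>, \<open>\<delta>\<close>\<close>

text \<open>
  Effectiveness of the arithmetic of \<open>D\<close>, \<open>\<sigma>\<close> and \<open>\<delta>\<close> means that the ring operations,
  inversion, the equality test and the maps \<open>\<sigma>\<close> and \<open>\<delta>\<close> are available as elementary steps.
  To compute is to run a finite program that has, besides these steps, only tree formation, projections,
  composition, branching and unbounded iteration.  The programs work on binary trees with leaves
  in \<open>D\<close>.  They contain no constants of \<open>D\<close> other than 0 and 1, and no polynomial operations
  (Euclidean division, greatest common divisors) are built in.
\<close>

datatype 'a data = Null | Scalar 'a | Node "'a data" "'a data"

datatype program =
    Skip | Seq program program
  | MkNull | MkNode program program | First | Second
  | Zero | One | Add | Minus | Mult | Inverse | Sigma | Delta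
  | IsZero
  | IfNull program program program
  | WhileNotNull program program

fun scalar_op1 :: "('a \<Rightarrow> 'a) \<Rightarrow> 'a data \<Rightarrow> 'a data option" where
  "scalar_op1 g (Scalar a) = Some (Scalar (g a))"
| "scalar_op1 g _ = None"

fun scalar_op2 :: "('a \<Rightarrow> 'a \<Rightarrow> 'a) \<Rightarrow> 'a data \<Rightarrow> 'a data option" where
  "scalar_op2 g (Node (Scalar a) (Scalar b)) = Some (Scalar (g a b))"
| "scalar_op2 g _ = None"

text \<open>Truth is represented by \<^const>\<open>Null\<close>.\<close>

fun zero_test :: "'a::zero data \<Rightarrow> 'a data option" where
  "zero_test (Scalar a) = Some (if a = 0 then Null else Node Null Null)"
| "zero_test _ = None"

partial_function (option) while_not_null ::
  "('a data \<Rightarrow> 'a data option) \<Rightarrow> ('a data \<Rightarrow> 'a data option) \<Rightarrow> 'a data \<Rightarrow> 'a data option" where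
  "while_not_null F G x =
     do { t \<leftarrow> F x; if t = Null then Some x else do { y \<leftarrow> G x; while_not_null F G y } }"

text \<open>The result \<^const>\<open>None\<close> covers both a run-time failure and non-termination.\<close>

primrec run ::
  "('a::division_ring \<Rightarrow> 'a) \<Rightarrow> ('a \<Rightarrow> 'a) \<Rightarrow> program \<Rightarrow> 'a data \<Rightarrow> 'a data option" where
  "run \<sigma> \<delta> Skip = Some"
| "run \<sigma> \<delta> (Seq P Q) = (\<lambda>x. do { y \<leftarrow> run \<sigma> \<delta> P x; run \<sigma> \<delta> Q y })"
| "run \<sigma> \<delta> MkNull = (\<lambda>x. Some Null)"
| "run \<sigma> \<delta> (MkNode P Q) =
     (\<lambda>x. do { y \<leftarrow> run \<sigma> \<delta> P x; z \<leftarrow> run \<sigma> \<delta> Q x; Some (Node y z) })"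
| "run \<sigma> \<delta> First = (\<lambda>x. case x of Node y z \<Rightarrow> Some y | _ \<Rightarrow> None)"
| "run \<sigma> \<delta> Second = (\<lambda>x. case x of Node y z \<Rightarrow> Some z | _ \<Rightarrow> None)"
| "run \<sigma> \<delta> Zero = (\<lambda>x. Some (Scalar 0))"
| "run \<sigma> \<delta> One = (\<lambda>x. Some (Scalar 1))"
| "run \<sigma> \<delta> Add = scalar_op2 (+)"
| "run \<sigma> \<delta> Minus = scalar_op1 uminus"
| "run \<sigma> \<delta> Mult = scalar_op2 (*)"
| "run \<sigma> \<delta> Inverse = scalar_op1 inverse"
| "run \<sigma> \<delta> Sigma = scalar_op1 \<sigma>"
| "run \<sigma> \<delta> Delta = scalar_op1 \<delta>"
| "run \<sigma> \<delta> IsZero = zero_test"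
| "run \<sigma> \<delta> (IfNull T P Q) =
     (\<lambda>x. do { t \<leftarrow> run \<sigma> \<delta> T x; if t = Null then run \<sigma> \<delta> P x else run \<sigma> \<delta> Q x })"
| "run \<sigma> \<delta> (WhileNotNull T P) = while_not_null (run \<sigma> \<delta> T) (run \<sigma> \<delta> P)"

primrec encode_list :: "'a data list \<Rightarrow> 'a data" where
  "encode_list [] = Null"
| "encode_list (x # xs) = Node x (encode_list xs)"

definition encode_poly :: "'a::zero poly \<Rightarrow> 'a data" where
  "encode_poly p = encode_list (map Scalar (coeffs p))"

definition encode_polys :: "'a::zero poly list \<Rightarrow> 'a data" where
  "encode_polys ps = encode_list (map encode_poly ps)"

end

theory Submission
  imports Defs
begin

text \<open>
  The factors are split off from the right. Put \<open>\<pi>' = \<pi>\<^sub>1 \<dots> \<pi>\<^sub>s\<^sub>-\<^sub>1\<close>, let \<open>R g = R f + R \<pi>\<^sub>s\<close> and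
  \<open>f = f' g\<close>. As \<open>\<pi>' (R f + R \<pi>\<^sub>s) \<subseteq> R f\<close>, the ideal \<open>R \<pi>'\<close> annihilates \<open>R / R f'\<close>;
  conversely, if \<open>b\<close> annihilates \<open>R / R f'\<close>, then \<open>b \<pi>\<^sub>s\<close> annihilates \<open>R / R f\<close>, so that
  \<open>b \<in> R \<pi>'\<close>. Hence \<open>\<pi>'\<close> is a bound of \<open>f'\<close>. The annihilator of \<open>R / R g\<close> contains
  \<open>R \<pi>\<^sub>s\<close>, which is maximal, and it is proper because otherwise \<open>\<pi>'\<close> would
  annihilate \<open>R / R f\<close>, against degrees. One continues with \<open>f'\<close>; what remains at the end
  is \<open>g\<^sub>1\<close>.

  All loops needed (Euclid's algorithm, long division) can be bounded by the length of a
  coefficient list that is at hand, so iterating along lists is the only recursion that has to be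
  programmed, and every function involved is total.
\<close>

section \<open>Arithmetic of skew polynomials\<close>

locale skew_polynomials =
  fixes \<sigma> \<delta> :: "'a::division_ring \<Rightarrow> 'a"
  assumes aut: "ring_automorphism \<sigma>" and der: "skew_derivation \<sigma> \<delta>"
begin

abbreviation mult (infixl "\<odot>" 70) where "p \<odot> q \<equiv> skew_mult \<sigma> \<delta> p q"
abbreviation X where "X \<equiv> X_mult \<sigma> \<delta>"
definition scal :: "'a \<Rightarrow> 'a poly \<Rightarrow> 'a poly" where "scal c p = map_poly (\<lambda>x. c * x) p"

lemma sigma_add: "\<sigma> (a + b) = \<sigma> a + \<sigma> b" and sigma_mult: "\<sigma> (a * b) = \<sigma> a * \<sigma> b"
  and sigma_1 [simp]: "\<sigma> 1 = 1"
  using aut by (auto simp: ring_automorphism_def)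

lemma delta_add: "\<delta> (a + b) = \<delta> a + \<delta> b" and delta_mult: "\<delta> (a * b) = \<sigma> a * \<delta> b + \<delta> a * b"
  using der by (auto simp: skew_derivation_def)

lemma sigma_0 [simp]: "\<sigma> 0 = 0"
  using sigma_add[of 0 0] by simp

lemma delta_0 [simp]: "\<delta> 0 = 0"
  using delta_add[of 0 0] by simp

lemma delta_1 [simp]: "\<delta> 1 = 0"
  using delta_mult[of 1 1] by simp

lemma sigma_eq_0_iff [simp]: "\<sigma> a = 0 \<longleftrightarrow> a = 0"
  using aut sigma_0 by (metis bij_pointE ring_automorphism_def)

lemma coeff_scal [simp]: "coeff (scal c p) n = c * coeff p n"
  by (simp add: scal_def coeff_map_poly)

lemma mult_def: "p \<odot> q = (\<Sum>i\<le>degree p. scal (coeff p i) ((X ^^ i) q))"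
  by (simp add: skew_mult_def scal_def)

lemma degree_map_poly_le: "h 0 = 0 \<Longrightarrow> degree (map_poly h p) \<le> degree p"
  by (intro degree_le) (simp add: coeff_map_poly coeff_eq_0)

lemma degree_scal_le: "degree (scal c p) \<le> degree p"
  by (simp add: scal_def degree_map_poly_le)

lemmas coeff_X = coeff_X_mult[OF aut der]

lemma scal_add: "scal c (p + q) = scal c p + scal c q"
  and scal_add_left: "scal (a + b) p = scal a p + scal b p"
  and scal_scal: "scal a (scal b p) = scal (a * b) p"
  and scal_1 [simp]: "scal 1 p = p"
  and scal_0 [simp]: "scal 0 p = 0"
  by (simp_all add: poly_eq_iff algebra_simps)

lemma scal_pCons: "scal c (pCons a p) = pCons (c * a) (scal c p)"
  by (auto simp: poly_eq_iff coeff_pCons split: nat.split)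

lemma scal_monom: "scal c (monom a n) = monom (c * a) n"
  by (auto simp: poly_eq_iff)

lemma scal_0_right [simp]: "scal c 0 = 0"
  by (simp add: poly_eq_iff)

lemma X_add: "X (p + q) = X p + X q"
  by (auto simp: poly_eq_iff coeff_X sigma_add delta_add split: nat.split)

lemma X_0 [simp]: "X 0 = 0"
  by (simp add: X_mult_def)

lemma X_scal: "X (scal c p) = scal (\<sigma> c) (X p) + scal (\<delta> c) p"
  by (auto simp: poly_eq_iff coeff_X sigma_mult delta_mult algebra_simps split: nat.split)

lemma X_sum: "X (sum h A) = (\<Sum>i\<in>A. X (h i))"
  by (induction A rule: infinite_finite_induct) (auto simp: X_add)

lemma X_funpow_add: "(X ^^ i) (p + q) = (X ^^ i) p + (X ^^ i) q"
  by (induction i) (auto simp: X_add)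

section \<open>The skew product: distributivity and associativity\<close>

lemma mult_eq_sum:
  assumes "degree p \<le> n"
  shows "p \<odot> q = (\<Sum>i\<le>n. scal (coeff p i) ((X ^^ i) q))"
proof -
  have "(\<Sum>i\<le>degree p. scal (coeff p i) ((X ^^ i) q)) = (\<Sum>i\<le>n. scal (coeff p i) ((X ^^ i) q))"
    using assms by (intro sum.mono_neutral_left) (auto simp: coeff_eq_0)
  thus ?thesis by (simp add: mult_def)
qed

lemma mult_0_left [simp]: "0 \<odot> q = 0"
  by (simp add: mult_def)

text \<open>Coefficients stand on the left, so \<open>pCons a p\<close> is \<open>a + p X\<close>,
  and \<open>(p X) q = p (X q)\<close>. Inductions on the left factor rest on this and need the
  right factor arbitrary.\<close>

lemma mult_pCons: "pCons a p \<odot> q = scal a q + p \<odot> X q"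
proof -
  have "pCons a p \<odot> q = (\<Sum>i\<le>Suc (degree p). scal (coeff (pCons a p) i) ((X ^^ i) q))"
    by (intro mult_eq_sum degree_pCons_le)
  also have "\<dots> = scal a q + (\<Sum>i\<le>degree p. scal (coeff p i) ((X ^^ i) (X q)))"
    by (simp only: sum.atMost_Suc_shift funpow_Suc_right) simp
  finally show ?thesis by (simp add: mult_def)
qed

lemma mult_add_left: "(p + p') \<odot> q = p \<odot> q + p' \<odot> q"
proof -
  \<comment> \<open>A common summation bound lets the three sums be compared termwise.\<close>
  define n where "n = max (degree p) (degree p')"
  have "degree p \<le> n" "degree p' \<le> n" "degree (p + p') \<le> n"
    by (auto simp: n_def degree_add_le_max)
  thus ?thesis
    by (simp add: mult_eq_sum[of _ n] scal_add_left sum.distrib)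
qed

lemma mult_add_right: "p \<odot> (q + q') = p \<odot> q + p \<odot> q'"
  by (simp add: mult_def X_funpow_add scal_add sum.distrib)

lemma mult_0_right [simp]: "p \<odot> 0 = 0"
  using mult_add_right[of p 0 0] by simp

lemma mult_minus_left: "(- p) \<odot> q = - (p \<odot> q)"
  using mult_add_left[of "- p" p q] by (simp add: eq_neg_iff_add_eq_0)

lemma mult_diff_left: "(p - p') \<odot> q = p \<odot> q - p' \<odot> q"
  using mult_add_left[of p "- p'" q] by (simp add: mult_minus_left)

lemma scal_mult: "scal c p \<odot> q = scal c (p \<odot> q)"
  by (induction p arbitrary: q) (auto simp: scal_pCons mult_pCons scal_add scal_scal)

text \<open>The case of associativity in which the commutation rule enters:
  \<open>X c = \<sigma>(c) X + \<delta>(c)\<close> is used for each coefficient \<open>c\<close> of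
  \<open>p\<close>, and \<open>X_scal\<close> matches the two resulting sums.\<close>

lemma X_mult_left: "X p \<odot> q = X (p \<odot> q)"
proof -
  have deg: "degree (map_poly \<sigma> p) \<le> degree p" "degree (map_poly \<delta> p) \<le> degree p"
    by (simp_all add: degree_map_poly_le)
  have "X p \<odot> q = map_poly \<sigma> p \<odot> X q + map_poly \<delta> p \<odot> q"
    by (simp add: X_mult_def[of _ _ p] mult_add_left mult_pCons)
  also have "\<dots> = (\<Sum>i\<le>degree p. scal (\<sigma> (coeff p i)) ((X ^^ i) (X q)) + scal (\<delta> (coeff p i)) ((X ^^ i) q))"
    by (simp add: mult_eq_sum[OF deg(1)] mult_eq_sum[OF deg(2)] coeff_map_poly sum.distrib)
  also have "\<dots> = X (p \<odot> q)"
    by (simp add: mult_def X_sum X_scal funpow_swap1)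
  finally show ?thesis .
qed

text \<open>Induction on \<open>p\<close>: the constant term is settled by \<open>scal_mult\<close>,
  the rest by the induction hypothesis for \<open>X q\<close>, as
  \<open>X q \<odot> r = X (q \<odot> r)\<close>.\<close>

lemma mult_assoc: "(p \<odot> q) \<odot> r = p \<odot> (q \<odot> r)"
  by (induction p arbitrary: q r) (auto simp: mult_pCons mult_add_left scal_mult X_mult_left)

lemma mult_1_left [simp]: "[:1:] \<odot> q = q"
  by (simp add: mult_pCons)

lemma X_monom: "X (monom 1 n) = monom 1 (Suc n)"
  by (auto simp: poly_eq_iff coeff_X split: nat.split)

lemma X_funpow_1: "(X ^^ n) [:1:] = monom 1 n"
  by (induction n) (auto simp: X_monom monom_0)

lemma mult_1_right [simp]: "p \<odot> [:1:] = p"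
proof -
  have "p \<odot> [:1:] = (\<Sum>i\<le>degree p. monom (coeff p i) i)"
    by (simp add: mult_def X_funpow_1 scal_monom)
  thus ?thesis by (simp add: poly_as_sum_of_monoms)
qed

lemma monom_mult: "monom c k \<odot> q = scal c ((X ^^ k) q)"
  by (induction k arbitrary: q) (simp_all add: monom_0 monom_Suc mult_pCons funpow_swap1)

section \<open>Degrees and the absence of zero divisors\<close>

lemma degree_scal: "c \<noteq> 0 \<Longrightarrow> degree (scal c p) = degree p"
  by (cases "p = 0") (auto intro!: antisym degree_scal_le le_degree)

lemma scal_eq_0_iff: "scal c p = 0 \<longleftrightarrow> c = 0 \<or> p = 0"
  by (auto simp: poly_eq_iff)

text \<open>The top coefficient is \<open>\<sigma>\<close> of the leading coefficient, nonzero by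
  injectivity; the \<open>\<delta>\<close> part does not exceed the degree of
  \<open>q\<close>.\<close>

lemma X_nonzero:
  assumes "q \<noteq> 0"
  shows "X q \<noteq> 0" "degree (X q) = Suc (degree q)"
proof -
  have "coeff (X q) (Suc (degree q)) \<noteq> 0"
    using assms by (simp add: coeff_X coeff_eq_0)
  moreover have "degree (X q) \<le> Suc (degree q)"
    by (intro degree_le) (auto simp: coeff_X coeff_eq_0 split: nat.split)
  ultimately show "X q \<noteq> 0" "degree (X q) = Suc (degree q)"
    by (auto intro: antisym le_degree)
qed

lemma X_funpow_nonzero:
  assumes "q \<noteq> 0"
  shows "(X ^^ k) q \<noteq> 0 \<and> degree ((X ^^ k) q) = k + degree q"
  using assms by (induction k) (auto simp: X_nonzero)

text \<open>In the inductive step \<open>p \<odot> X q\<close> has larger degree than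
  \<open>scal a q\<close>, so nothing cancels at the top.\<close>

lemma mult_nonzero:
  assumes "p \<noteq> 0" "q \<noteq> 0"
  shows "p \<odot> q \<noteq> 0 \<and> degree (p \<odot> q) = degree p + degree q"
  using assms
proof (induction p arbitrary: q)
  case (pCons a p)
  show ?case
  proof (cases "p = 0")
    case True
    thus ?thesis using pCons by (simp add: mult_pCons scal_eq_0_iff degree_scal)
  next
    case False
    hence *: "degree (p \<odot> X q) = Suc (degree p + degree q)"
      using pCons.IH[of "X q"] X_nonzero[of q] pCons.prems by simp
    moreover have "degree (scal a q) \<le> degree q" by (rule degree_scal_le)
    ultimately have "degree (scal a q + p \<odot> X q) = Suc (degree p + degree q)"
      by (subst degree_add_eq_right) auto
    thus ?thesis using False by (auto simp: mult_pCons)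
  qed
qed simp

lemma mult_eq_0_iff [simp]: "p \<odot> q = 0 \<longleftrightarrow> p = 0 \<or> q = 0"
  using mult_nonzero[of p q] by auto

lemma degree_mult: "p \<noteq> 0 \<Longrightarrow> q \<noteq> 0 \<Longrightarrow> degree (p \<odot> q) = degree p + degree q"
  using mult_nonzero by blast

lemma mult_right_cancel: "q \<noteq> 0 \<Longrightarrow> p \<odot> q = p' \<odot> q \<longleftrightarrow> p = p'"
  using mult_eq_0_iff[of "p - p'" q] by (simp add: mult_diff_left)

lemma ring_skew_poly_ring: "ring (skew_poly_ring \<sigma> \<delta>)"
proof (rule ringI)
  show "abelian_group (skew_poly_ring \<sigma> \<delta>)"
    by (rule abelian_groupI)
      (auto simp: skew_poly_ring_def algebra_simps intro: exI[of _ "- x" for x] left_minus)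
  show "monoid (skew_poly_ring \<sigma> \<delta>)"
    by (rule monoidI) (auto simp: skew_poly_ring_def mult_assoc)
qed (auto simp: skew_poly_ring_def mult_add_left mult_add_right)


section \<open>Division and greatest common right divisors\<close>

text \<open>One step of long division on a pair of quotient and remainder: subtracting
  \<open>c X^k g\<close> cancels the leading term. The leading coefficient is read off
  \<open>X^k g\<close>, since \<open>\<sigma>\<close> twists that of \<open>g\<close>. Lengths
  replace degrees because they separate 0 from the nonzero constants. A short remainder is left
  alone, so surplus iterations are harmless.\<close>

definition rdiv_step :: "'a poly \<Rightarrow> 'a poly \<times> 'a poly \<Rightarrow> 'a poly \<times> 'a poly" where
  "rdiv_step g z =
     (let k = length (coeffs (snd z)) - length (coeffs g);
          h = (X ^^ k) g;
          c = lead_coeff (snd z) * inverse (lead_coeff h)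
      in if length (coeffs g) \<le> length (coeffs (snd z))
         then (fst z + monom c k, snd z + scal (- c) h) else z)"

definition rdiv :: "'a poly \<Rightarrow> 'a poly \<Rightarrow> 'a poly \<times> 'a poly" where
  "rdiv f g = (rdiv_step g ^^ length (coeffs f)) (0, f)"

text \<open>Idle once the second component is 0. That component gets strictly shorter, so the length
  of \<open>p\<close> bounds the number of steps in \<open>gcrd\<close>.\<close>

definition gcrd_step :: "'a poly \<times> 'a poly \<Rightarrow> 'a poly \<times> 'a poly" where
  "gcrd_step z = (if snd z = 0 then z else (snd z, snd (rdiv (fst z) (snd z))))"

definition gcrd :: "'a poly \<Rightarrow> 'a poly \<Rightarrow> 'a poly" where
  "gcrd f p = fst ((gcrd_step ^^ length (coeffs p)) (f, p))"

section \<open>Correctness of long division and of Euclid's algorithm\<close>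

lemma rdiv_step_length:
  assumes "g \<noteq> 0" "length (coeffs g) \<le> length (coeffs (snd z))"
  shows "length (coeffs (snd (rdiv_step g z))) < length (coeffs (snd z))"
proof -
  define r where "r = snd z"
  define k where "k = length (coeffs r) - length (coeffs g)"
  define h where "h = (X ^^ k) g"
  define c where "c = lead_coeff r * inverse (lead_coeff h)"
  have r: "r \<noteq> 0" using assms by (auto simp: r_def)
  hence dg: "degree g \<le> degree r" and k: "k = degree r - degree g"
    using assms by (auto simp: k_def length_coeffs_degree simp flip: r_def)
  have h: "h \<noteq> 0" "degree h = degree r"
    using X_funpow_nonzero[OF assms(1), of k] dg k by (auto simp: h_def)
  have "lead_coeff h \<noteq> 0" using h(1) by simp
  hence top: "coeff (r + scal (- c) h) (degree r) = 0"
    using h by (simp add: c_def mult.assoc)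
  have "degree (r + scal (- c) h) \<le> degree r"
    by (rule degree_add_le) (auto intro: order_trans[OF degree_scal_le] simp: h)
  hence "r + scal (- c) h = 0 \<or> degree (r + scal (- c) h) < degree r"
    using top by (metis le_neq_implies_less leading_coeff_0_iff)
  hence "length (coeffs (r + scal (- c) h)) < length (coeffs r)"
    using r by (cases "r + scal (- c) h = 0") (auto simp: length_coeffs_degree)
  thus ?thesis using assms by (simp add: rdiv_step_def Let_def r_def k_def h_def c_def)
qed

lemma rdiv_step_invariant:
  "fst (rdiv_step g z) \<odot> g + snd (rdiv_step g z) = fst z \<odot> g + snd z"
proof -
  have "scal c h + (r + scal (- c) h) = r" for c r and h :: "'a poly"
    by (simp add: poly_eq_iff)
  thus ?thesis
    by (simp add: rdiv_step_def Let_def mult_add_left monom_mult add.assoc)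
qed

lemma rdiv_eq: "f = fst (rdiv f g) \<odot> g + snd (rdiv f g)"
proof -
  have "fst ((rdiv_step g ^^ n) z) \<odot> g + snd ((rdiv_step g ^^ n) z) = fst z \<odot> g + snd z" for n z
    by (induction n) (auto simp: rdiv_step_invariant)
  from this[of "length (coeffs f)" "(0, f)"] show ?thesis by (simp add: rdiv_def)
qed

lemma rdiv_length:
  assumes "g \<noteq> 0"
  shows "length (coeffs (snd (rdiv f g))) < length (coeffs g)"
proof -
  \<comment> \<open>Either the remainder is already shorter than \<open>g\<close>, or each of the
    \<open>n\<close> steps has removed a coefficient. For \<open>n = length (coeffs f)\<close> the
    second case leaves the empty list.\<close>
  have "length (coeffs (snd ((rdiv_step g ^^ n) (0, f)))) < length (coeffs g) \<or>
        length (coeffs (snd ((rdiv_step g ^^ n) (0, f)))) + n \<le> length (coeffs f)" for n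
  proof (induction n)
    case (Suc n)
    define z where "z = (rdiv_step g ^^ n) (0, f)"
    show ?case
    proof (cases "length (coeffs g) \<le> length (coeffs (snd z))")
      case True
      thus ?thesis using Suc rdiv_step_length[OF assms True] by (simp add: z_def)
    next
      case False
      hence "rdiv_step g z = z" by (simp add: rdiv_step_def)
      thus ?thesis using False by (simp add: z_def)
    qed
  qed simp
  from this[of "length (coeffs f)"] show ?thesis
    using assms by (auto simp: rdiv_def)
qed

text \<open>The remainder is a left multiple \<open>(c - q) \<odot> g\<close> that is shorter than
  \<open>g\<close>; additivity of degrees forces \<open>c = q\<close>.\<close>

lemma rdiv_exact:
  assumes "g \<noteq> 0"
  shows "fst (rdiv (c \<odot> g) g) = c"
proof -
  define q r where "q = fst (rdiv (c \<odot> g) g)" and "r = snd (rdiv (c \<odot> g) g)"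
  have r: "(c - q) \<odot> g = r"
    using rdiv_eq[of "c \<odot> g" g] unfolding q_def r_def by (metis add_diff_cancel_left' mult_diff_left)
  have "length (coeffs r) < length (coeffs g)" using rdiv_length[OF assms] by (simp add: r_def)
  moreover have "length (coeffs r) \<ge> length (coeffs g)" if "c - q \<noteq> 0"
    using that assms degree_mult[OF that assms] r by (auto simp: length_coeffs_degree)
  ultimately show ?thesis by (fastforce simp: q_def)
qed

text \<open>As \<open>a = q b + r\<close>, the pairs \<open>(a, b)\<close> and \<open>(b, r)\<close>
  generate the same left ideal.\<close>

lemma gcrd_step_ideal:
  "{u \<odot> fst (gcrd_step z) + v \<odot> snd (gcrd_step z) | u v. True} = {u \<odot> fst z + v \<odot> snd z | u v. True}"
proof (cases "snd z = 0")
  case False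
  define a b q r where "a = fst z" and "b = snd z" and "q = fst (rdiv a b)" and "r = snd (rdiv a b)"
  have a: "a = q \<odot> b + r" unfolding q_def r_def by (rule rdiv_eq)
  have 1: "u \<odot> b + v \<odot> r = v \<odot> a + (u - v \<odot> q) \<odot> b" for u v
    by (simp add: a mult_diff_left mult_add_right mult_assoc)
  have 2: "u \<odot> a + v \<odot> b = (u \<odot> q + v) \<odot> b + u \<odot> r" for u v
    by (simp add: a mult_add_left mult_add_right mult_assoc)
  have "{u \<odot> b + v \<odot> r | u v. True} = {u \<odot> a + v \<odot> b | u v. True}"
    using 1 2 by blast
  thus ?thesis using False by (simp add: gcrd_step_def a_def b_def r_def)
qed (simp add: gcrd_step_def)

lemma gcrd_ideal: "range (\<lambda>c. c \<odot> gcrd f p) = {u \<odot> f + v \<odot> p | u v. True}"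
proof -
  define z where "z n = (gcrd_step ^^ n) (f, p)" for n
  have "length (coeffs (snd (z n))) + n \<le> length (coeffs p) \<or> snd (z n) = 0" for n
  proof (induction n)
    case (Suc n)
    have *: "z (Suc n) = gcrd_step (z n)" by (simp add: z_def)
    show ?case
    proof (cases "snd (z n) = 0")
      case False
      thus ?thesis using Suc rdiv_length[OF False, of "fst (z n)"] by (simp add: * gcrd_step_def)
    qed (simp add: * gcrd_step_def)
  qed (simp add: z_def)
  \<comment> \<open>By now the second component has vanished, so the first alone generates the left
    ideal.\<close>
  from this[of "length (coeffs p)"] have 0: "snd (z (length (coeffs p))) = 0" by auto
  have "{u \<odot> fst (z n) + v \<odot> snd (z n) | u v. True} = {u \<odot> f + v \<odot> p | u v. True}" for n
    unfolding z_def by (induction n) (simp, simp only: funpow.simps o_apply gcrd_step_ideal)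
  from this[of "length (coeffs p)"] show ?thesis
    by (auto simp: 0 gcrd_def full_SetCompr_eq simp flip: z_def)
qed


section \<open>Bounds and the factorization\<close>

abbreviation R where "R \<equiv> skew_poly_ring \<sigma> \<delta>"

lemma skew_poly_ring_simps [simp]:
  "carrier R = UNIV" "p \<otimes>\<^bsub>R\<^esub> q = p \<odot> q" "\<one>\<^bsub>R\<^esub> = [:1:]" "\<zero>\<^bsub>R\<^esub> = 0" "p \<oplus>\<^bsub>R\<^esub> q = p + q"
  by (simp_all add: skew_poly_ring_def)

section \<open>Principal left ideals and twosided elements\<close>

lemma principal_left_ideal: "carrier R #>\<^bsub>R\<^esub> f = range (\<lambda>c. c \<odot> f)"
  by (auto simp: r_coset_def)

lemma twosided_iff: "twosided R a \<longleftrightarrow> range (\<lambda>c. c \<odot> a) = range (\<lambda>c. a \<odot> c)"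
  by (auto simp: twosided_def r_coset_def l_coset_def)

lemma twosidedE:
  assumes "twosided R a"
  obtains c' where "a \<odot> c = c' \<odot> a"
  using assms unfolding twosided_iff by blast

lemma twosidedE':
  assumes "twosided R a"
  obtains c' where "c \<odot> a = a \<odot> c'"
  using assms unfolding twosided_iff by blast

lemma twosided_1: "twosided R [:1:]"
  by (simp add: twosided_iff)

lemma twosided_mult:
  assumes "twosided R a" "twosided R b"
  shows "twosided R (a \<odot> b)"
  unfolding twosided_iff
proof safe
  fix c
  obtain c' where "c \<odot> a = a \<odot> c'" using twosidedE'[OF assms(1)] .
  moreover obtain c'' where "c' \<odot> b = b \<odot> c''" using twosidedE'[OF assms(2)] .
  ultimately have "c \<odot> (a \<odot> b) = (a \<odot> b) \<odot> c''" by (metis mult_assoc)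
  thus "c \<odot> (a \<odot> b) \<in> range (\<lambda>c. (a \<odot> b) \<odot> c)" by blast
next
  fix c
  obtain c' where "b \<odot> c = c' \<odot> b" using twosidedE[OF assms(2)] .
  moreover obtain c'' where "a \<odot> c' = c'' \<odot> a" using twosidedE[OF assms(1)] .
  ultimately have "(a \<odot> b) \<odot> c = c'' \<odot> (a \<odot> b)" by (metis mult_assoc)
  thus "(a \<odot> b) \<odot> c \<in> range (\<lambda>c. c \<odot> (a \<odot> b))" by blast
qed

section \<open>Annihilators of cyclic left modules and bounds\<close>

lemma ann_quotient_iff:
  "r \<in> ann_quotient R (carrier R #>\<^bsub>R\<^esub> f) \<longleftrightarrow> (\<forall>a. \<exists>c. r \<odot> a = c \<odot> f)"
proof -
  have "range (\<lambda>c. c \<odot> f) +>\<^bsub>R\<^esub> x = range (\<lambda>c. c \<odot> f) \<longleftrightarrow> (\<exists>c. x = c \<odot> f)" for x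
  proof
    assume "range (\<lambda>c. c \<odot> f) +>\<^bsub>R\<^esub> x = range (\<lambda>c. c \<odot> f)"
    \<comment> \<open>An element lies in its own coset, through the zero multiple of
      \<open>f\<close>.\<close>
    moreover have "0 \<odot> f + x \<in> range (\<lambda>c. c \<odot> f) +>\<^bsub>R\<^esub> x"
      unfolding a_r_coset_def' by (simp del: mult_0_left) blast
    ultimately show "\<exists>c. x = c \<odot> f" by auto
  next
    assume "\<exists>c. x = c \<odot> f"
    then obtain c where x: "x = c \<odot> f" by blast
    have "range (\<lambda>c. c \<odot> f) +>\<^bsub>R\<^esub> x = range (\<lambda>b. b \<odot> f + x)"
      by (auto simp: a_r_coset_def')
    also have "\<dots> = (\<lambda>b. b \<odot> f) ` range (\<lambda>b. b + c)"
      by (simp only: x image_image mult_add_left)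
    \<comment> \<open>Translation by \<open>c\<close> only permutes the multipliers of
      \<open>f\<close>.\<close>
    also have "range (\<lambda>b. b + c) = UNIV"
      by simp
    finally show "range (\<lambda>c. c \<odot> f) +>\<^bsub>R\<^esub> x = range (\<lambda>c. c \<odot> f)" .
  qed
  thus ?thesis unfolding ann_quotient_def principal_left_ideal by simp
qed

text \<open>Supplies the ideal to which maximality of \<open>R \<pi>\<close> is applied. It is
  closed under right multiplication because \<open>a\<close> ranges over all of \<open>R\<close>:
  \<open>(r x) a = r (x a)\<close>.\<close>

lemma ideal_ann_quotient: "ideal (ann_quotient R (carrier R #>\<^bsub>R\<^esub> f)) R" (is "ideal ?A R")
proof (rule idealI[OF ring_skew_poly_ring])
  interpret ring R by (rule ring_skew_poly_ring)
  show "subgroup ?A (add_monoid R)"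
  proof (rule add.subgroupI)
    have "0 \<in> ?A" unfolding ann_quotient_iff by (metis mult_0_left)
    thus "?A \<noteq> {}" by blast
    show "\<ominus>\<^bsub>R\<^esub> r \<in> ?A" if "r \<in> ?A" for r
    proof -
      have "r + (- r) = 0" by simp
      hence "\<ominus>\<^bsub>R\<^esub> r = - r" using minus_equality[of "- r" r] by simp
      thus ?thesis using that unfolding ann_quotient_iff by (metis mult_minus_left)
    qed
    show "r \<oplus>\<^bsub>R\<^esub> s \<in> ?A" if "r \<in> ?A" "s \<in> ?A" for r s
      using that unfolding ann_quotient_iff by (metis mult_add_left skew_poly_ring_simps(5))
  qed simp
  show "x \<otimes>\<^bsub>R\<^esub> r \<in> ?A" if "r \<in> ?A" for r x
    using that unfolding ann_quotient_iff by (metis mult_assoc skew_poly_ring_simps(2))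
  show "r \<otimes>\<^bsub>R\<^esub> x \<in> ?A" if "r \<in> ?A" for r x
    using that unfolding ann_quotient_iff by (metis mult_assoc skew_poly_ring_simps(2))
qed

lemma is_bound_iff:
  "is_bound R f b \<longleftrightarrow> twosided R b \<and> (\<forall>r. (\<exists>c. r = c \<odot> b) \<longleftrightarrow> (\<forall>a. \<exists>c. r \<odot> a = c \<odot> f))"
  unfolding is_bound_def set_eq_iff ann_quotient_iff unfolding principal_left_ideal image_iff
  by simp

text \<open>A single splitting, for any generator \<open>g\<close> of \<open>R f + R \<pi>\<close>,
  whatever algorithm produces it. Twosidedness moves \<open>\<pi>'\<close> and \<open>\<pi>\<close>
  past arbitrary elements; right cancellation then removes \<open>g\<close> and
  \<open>\<pi>\<close>.\<close>

lemma bound_split: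
  assumes bound: "is_bound R f (\<pi>' \<odot> \<pi>)" and "\<pi>' \<noteq> 0"
    and \<pi>': "twosided R \<pi>'" and \<pi>: "prime_twosided R \<pi>"
    and g: "range (\<lambda>c. c \<odot> g) = {u \<odot> f + v \<odot> \<pi> | u v. True}" and f: "f = f' \<odot> g"
  shows "is_bound R f' \<pi>'" "is_bound R g \<pi>"
proof -
  have ts: "twosided R \<pi>" and deg: "degree \<pi> > 0"
    and max: "maximalideal (carrier R #>\<^bsub>R\<^esub> \<pi>) R"
    using \<pi> by (auto simp: prime_twosided_def)
  have "\<pi> \<noteq> 0" using deg by auto
  have ann: "(\<exists>c. r = c \<odot> (\<pi>' \<odot> \<pi>)) \<longleftrightarrow> (\<forall>a. \<exists>c. r \<odot> a = c \<odot> f)" for r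
    using bound by (simp add: is_bound_iff)
  obtain u v where g_eq: "g = u \<odot> f + v \<odot> \<pi>"
    using g rangeI[of "\<lambda>c. c \<odot> g" "[:1:]"] by auto
  have "\<pi> = 0 \<odot> f + [:1:] \<odot> \<pi>" by simp
  then obtain h where h: "\<pi> = h \<odot> g" using g by blast
  have "g \<noteq> 0" using h \<open>\<pi> \<noteq> 0\<close> by auto

  have \<pi>'_ann: "\<exists>c. \<pi>' \<odot> a = c \<odot> f'" for a
  proof -
    \<comment> \<open>Moving \<open>\<pi>'\<close> past \<open>a v\<close> turns
      \<open>\<pi>' a v \<pi>\<close> into a left multiple of the bound of \<open>f\<close>, hence
      into an element of \<open>R f\<close>.\<close>
    obtain w where w: "\<pi>' \<odot> (a \<odot> v) = w \<odot> \<pi>'" using twosidedE[OF \<pi>'] .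
    have "\<exists>c. w \<odot> (\<pi>' \<odot> \<pi>) = c \<odot> f"
      using ann[of "w \<odot> (\<pi>' \<odot> \<pi>)"] by (metis mult_1_right)
    then obtain c where c: "w \<odot> (\<pi>' \<odot> \<pi>) = c \<odot> f" by blast
    have "(\<pi>' \<odot> a) \<odot> g = (\<pi>' \<odot> a \<odot> u) \<odot> f + \<pi>' \<odot> (a \<odot> v) \<odot> \<pi>"
      by (simp add: g_eq mult_add_right mult_assoc)
    also have "\<dots> = (\<pi>' \<odot> a \<odot> u + c) \<odot> f"
      by (simp add: w c mult_assoc mult_add_left)
    also have "\<dots> = ((\<pi>' \<odot> a \<odot> u + c) \<odot> f') \<odot> g"
      by (simp add: f mult_assoc)
    finally show ?thesis using mult_right_cancel[OF \<open>g \<noteq> 0\<close>] by blast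
  qed

  have "(\<exists>c. r = c \<odot> \<pi>') \<longleftrightarrow> (\<forall>a. \<exists>c. r \<odot> a = c \<odot> f')" for r
  proof
    assume "\<exists>c. r = c \<odot> \<pi>'"
    thus "\<forall>a. \<exists>c. r \<odot> a = c \<odot> f'" using \<pi>'_ann by (metis mult_assoc)
  next
    assume r: "\<forall>a. \<exists>c. r \<odot> a = c \<odot> f'"
    \<comment> \<open>Here \<open>r \<pi> a = r a' \<pi> = (r a' h) g\<close>, and
      \<open>r a' h\<close> lies in \<open>R f'\<close>, so the product lies in
      \<open>R f' g = R f\<close>.\<close>
    have "\<exists>c. (r \<odot> \<pi>) \<odot> a = c \<odot> f" for a
    proof -
      obtain a' where a': "\<pi> \<odot> a = a' \<odot> \<pi>" using twosidedE[OF ts] .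
      obtain c where c: "r \<odot> (a' \<odot> h) = c \<odot> f'" using r by blast
      have "(r \<odot> \<pi>) \<odot> a = r \<odot> (a' \<odot> h) \<odot> g" using a' h by (simp add: mult_assoc)
      also have "\<dots> = c \<odot> f" using c f by (simp add: mult_assoc)
      finally show ?thesis by blast
    qed
    then obtain c where "r \<odot> \<pi> = c \<odot> (\<pi>' \<odot> \<pi>)" using ann by blast
    hence "r \<odot> \<pi> = (c \<odot> \<pi>') \<odot> \<pi>" by (simp add: mult_assoc)
    thus "\<exists>c. r = c \<odot> \<pi>'" using mult_right_cancel[OF \<open>\<pi> \<noteq> 0\<close>] by blast
  qed
  thus "is_bound R f' \<pi>'" using \<pi>' by (simp add: is_bound_iff)

  let ?A = "ann_quotient R (carrier R #>\<^bsub>R\<^esub> g)"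
  have "carrier R #>\<^bsub>R\<^esub> \<pi> \<subseteq> ?A"
  proof
    fix r assume "r \<in> carrier R #>\<^bsub>R\<^esub> \<pi>"
    then obtain b where "r = b \<odot> \<pi>" unfolding principal_left_ideal by blast
    \<comment> \<open>For every \<open>a\<close> there is \<open>a'\<close> with
      \<open>b \<pi> a = b a' \<pi> = (b a' h) g\<close>.\<close>
    thus "r \<in> ?A" unfolding ann_quotient_iff by (metis h mult_assoc twosidedE[OF ts])
  qed
  hence "?A = carrier R #>\<^bsub>R\<^esub> \<pi> \<or> ?A = carrier R"
    using maximalideal.I_maximal[OF max ideal_ann_quotient] by simp
  moreover have "?A \<noteq> carrier R"
  proof
    assume "?A = carrier R"
    hence "[:1:] \<in> ?A" by simp
    then obtain t where t: "[:1:] = t \<odot> g" unfolding ann_quotient_iff by (metis mult_1_left)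
    \<comment> \<open>If \<open>g\<close> is a unit, then already \<open>\<pi>'\<close> annihilates \<open>R / R f\<close>.\<close>
    have "\<exists>c. \<pi>' \<odot> a = c \<odot> f" for a
    proof -
      obtain c where "\<pi>' \<odot> (a \<odot> t) = c \<odot> f'" using \<pi>'_ann by blast
      hence "\<pi>' \<odot> (a \<odot> t) \<odot> g = c \<odot> f" by (simp add: f mult_assoc)
      thus ?thesis using t by (metis mult_1_right mult_assoc)
    qed
    then obtain c where c: "\<pi>' = c \<odot> (\<pi>' \<odot> \<pi>)" using ann[of \<pi>'] by blast
    hence "c \<noteq> 0" using \<open>\<pi>' \<noteq> 0\<close> by auto
    \<comment> \<open>Degrees add up, which is incompatible with
      \<open>degree \<pi> > 0\<close>.\<close>
    hence "degree \<pi>' = degree c + (degree \<pi>' + degree \<pi>)"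
      using \<open>\<pi>' \<noteq> 0\<close> \<open>\<pi> \<noteq> 0\<close> by (metis c degree_mult mult_eq_0_iff)
    thus False using deg by simp
  qed
  ultimately show "is_bound R g \<pi>" using ts by (simp add: is_bound_def)
qed

section \<open>Splitting off all prime factors in turn\<close>

lemma list_prod_simps [simp]:
  "list_prod R [] = [:1:]" "list_prod R (p # ps) = p \<odot> list_prod R ps"
  by (simp_all add: list_prod_def)

lemma list_prod_append: "list_prod R (ps @ qs) = list_prod R ps \<odot> list_prod R qs"
  by (induction ps) (simp_all add: mult_assoc)

lemma list_prod_prime_twosided:
  assumes "\<forall>p \<in> set ps. prime_twosided R p"
  shows "twosided R (list_prod R ps)" "list_prod R ps \<noteq> 0"
  using assms by (induction ps) (auto simp: twosided_1 twosided_mult prime_twosided_def)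

text \<open>The state holds the left cofactor still to be split and the list of factors already
  taken off its right end.\<close>

definition split_step :: "'a poly \<Rightarrow> 'a poly \<times> 'a poly list \<Rightarrow> 'a poly \<times> 'a poly list" where
  "split_step \<pi> z = (fst (rdiv (fst z) (gcrd (fst z) \<pi>)), gcrd (fst z) \<pi> # snd z)"

text \<open>\<open>foldr\<close> meets the last prime first, as splitting from the right requires.
  The head of \<open>\<pi>s\<close> is left out: the cofactor that remains has it as its
  bound.\<close>

definition bound_factors :: "'a poly \<Rightarrow> 'a poly list \<Rightarrow> 'a poly list" where
  "bound_factors f \<pi>s = (let z = foldr split_step (tl \<pi>s) (f, []) in fst z # snd z)"

lemma split_step_correct:
  assumes "is_bound R f (list_prod R \<pi>s)" "\<pi>s = ps @ [\<pi>]" "\<forall>p \<in> set \<pi>s. prime_twosided R p"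
  shows "\<exists>f' g. split_step \<pi> (f, gs) = (f', g # gs) \<and> f = f' \<odot> g \<and>
           is_bound R f' (list_prod R ps) \<and> is_bound R g \<pi>"
proof -
  define g where "g = gcrd f \<pi>"
  have g: "range (\<lambda>c. c \<odot> g) = {u \<odot> f + v \<odot> \<pi> | u v. True}"
    unfolding g_def by (rule gcrd_ideal)
  have "f = [:1:] \<odot> f + 0 \<odot> \<pi>" "\<pi> = 0 \<odot> f + [:1:] \<odot> \<pi>" by simp_all
  then obtain f' h where f': "f = f' \<odot> g" and h: "\<pi> = h \<odot> g" using g by blast
  have "\<pi> \<noteq> 0" using assms by (auto simp: prime_twosided_def)
  hence "g \<noteq> 0" using h by auto
  \<comment> \<open>The quotient is unique, so the computed one is the cofactor \<open>f'\<close>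
    just obtained.\<close>
  hence "fst (rdiv f g) = f'" using f' rdiv_exact by simp
  hence "split_step \<pi> (f, gs) = (f', g # gs)" by (simp add: split_step_def g_def)
  moreover have "is_bound R f' (list_prod R ps)" "is_bound R g \<pi>"
    using bound_split[OF _ _ _ _ g f', of "list_prod R ps"] assms list_prod_prime_twosided[of ps]
    by (auto simp: list_prod_append)
  ultimately show ?thesis using f' by blast
qed

text \<open>Induction from the end of the list follows the order in which \<open>foldr\<close>
  works. Arbitrary \<open>gs\<close> let the factors accumulate, and \<open>\<pi>\<close> in front
  is the bound left for the final cofactor.\<close>

lemma foldr_split_step:
  assumes "is_bound R f (list_prod R (\<pi> # ps))" "\<forall>p \<in> set (\<pi> # ps). prime_twosided R p"
  shows "\<exists>h gs'. foldr split_step ps (f, gs) = (h, gs' @ gs) \<and> f = h \<odot> list_prod R gs' \<and>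
           is_bound R h \<pi> \<and> list_all2 (is_bound R) gs' ps"
  using assms
proof (induction ps arbitrary: f gs rule: rev_induct)
  case Nil
  thus ?case by simp
next
  case (snoc p ps)
  obtain f' g where 1: "split_step p (f, gs) = (f', g # gs)" "f = f' \<odot> g"
      "is_bound R f' (list_prod R (\<pi> # ps))" "is_bound R g p"
    using split_step_correct[OF snoc.prems(1) _ snoc.prems(2), of "\<pi> # ps" p gs] by (metis append_Cons)
  have "\<forall>q \<in> set (\<pi> # ps). prime_twosided R q" using snoc.prems(2) by simp
  then obtain h gs' where 2: "foldr split_step ps (f', g # gs) = (h, gs' @ g # gs)"
      "f' = h \<odot> list_prod R gs'" "is_bound R h \<pi>" "list_all2 (is_bound R) gs' ps"
    using snoc.IH[OF 1(3), of "g # gs"] by blast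
  have "foldr split_step (ps @ [p]) (f, gs) = (h, (gs' @ [g]) @ gs)"
    using 1(1) 2(1) by simp
  moreover have "f = h \<odot> list_prod R (gs' @ [g])"
    by (simp add: 1(2) 2(2) list_prod_append mult_assoc)
  moreover have "list_all2 (is_bound R) (gs' @ [g]) (ps @ [p])"
    using 1(4) 2(4) by (simp add: list_all2_appendI)
  ultimately show ?case using 2(3) by blast
qed

theorem bound_factors_correct:
  assumes "is_bound R f (list_prod R \<pi>s)" "\<pi>s \<noteq> []" "\<forall>p \<in> set \<pi>s. prime_twosided R p"
  shows "f = list_prod R (bound_factors f \<pi>s)" "list_all2 (is_bound R) (bound_factors f \<pi>s) \<pi>s"
proof -
  obtain \<pi> ps where \<pi>s: "\<pi>s = \<pi> # ps" using assms(2) by (cases \<pi>s) auto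
  obtain h gs where "foldr split_step ps (f, []) = (h, gs)" "f = h \<odot> list_prod R gs"
      "is_bound R h \<pi>" "list_all2 (is_bound R) gs ps"
    using foldr_split_step[of f \<pi> ps "[]"] assms \<pi>s by auto
  thus "f = list_prod R (bound_factors f \<pi>s)" "list_all2 (is_bound R) (bound_factors f \<pi>s) \<pi>s"
    by (simp_all add: bound_factors_def \<pi>s)
qed


section \<open>Programs for the algorithms\<close>

definition enc_pair :: "('b \<Rightarrow> 'a data) \<Rightarrow> ('c \<Rightarrow> 'a data) \<Rightarrow> 'b \<times> 'c \<Rightarrow> 'a data" where
  "enc_pair e1 e2 z = Node (e1 (fst z)) (e2 (snd z))"

definition enc_list :: "('b \<Rightarrow> 'a data) \<Rightarrow> 'b list \<Rightarrow> 'a data" where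
  "enc_list e xs = encode_list (map e xs)"

definition enc_bool :: "bool \<Rightarrow> 'a data" where
  "enc_bool b = (if b then Null else Node Null Null)"

text \<open>In the rules below the input encoding \<open>e\<close> stays free. It acts as an
  environment from which all arguments are computed, so that the rules compose along the syntax of a
  function.\<close>

definition computable :: "('b \<Rightarrow> 'a data) \<Rightarrow> ('c \<Rightarrow> 'a data) \<Rightarrow> ('b \<Rightarrow> 'c) \<Rightarrow> bool" where
  "computable e e' h \<longleftrightarrow> (\<exists>P. \<forall>x. run \<sigma> \<delta> P (e x) = Some (e' (h x)))"

lemma computableI: "(\<And>x. run \<sigma> \<delta> P (e x) = Some (e' (h x))) \<Longrightarrow> computable e e' h"
  by (auto simp: computable_def)

lemma enc_list_simps [simp]:
  "enc_list e [] = Null" "enc_list e (x # xs) = Node (e x) (enc_list e xs)"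
  by (simp_all add: enc_list_def)

lemma encode_poly_coeffs: "encode_poly p = enc_list Scalar (coeffs p)"
  by (simp add: encode_poly_def enc_list_def)

section \<open>Closure under composition, scalar operations and branching\<close>

lemma computable_id: "computable e e (\<lambda>x. x)"
  by (rule computableI[of Skip]) simp

lemma computable_comp:
  assumes "computable e e1 f" "computable e1 e2 g"
  shows "computable e e2 (\<lambda>x. g (f x))"
proof -
  obtain P Q where "\<And>x. run \<sigma> \<delta> P (e x) = Some (e1 (f x))" "\<And>x. run \<sigma> \<delta> Q (e1 x) = Some (e2 (g x))"
    using assms unfolding computable_def by blast
  thus ?thesis by (intro computableI[of "Seq P Q"]) simp
qed

lemma computable_Pair:
  assumes "computable e e1 f" "computable e e2 g"
  shows "computable e (enc_pair e1 e2) (\<lambda>x. (f x, g x))"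
proof -
  obtain P Q where "\<And>x. run \<sigma> \<delta> P (e x) = Some (e1 (f x))" "\<And>x. run \<sigma> \<delta> Q (e x) = Some (e2 (g x))"
    using assms unfolding computable_def by blast
  thus ?thesis by (intro computableI[of "MkNode P Q"]) (simp add: enc_pair_def)
qed

lemma computable_comp2:
  assumes "computable e e1 f" "computable e e2 g" "computable (enc_pair e1 e2) e3 (\<lambda>z. h (fst z) (snd z))"
  shows "computable e e3 (\<lambda>x. h (f x) (g x))"
  using computable_comp[OF computable_Pair[OF assms(1,2)] assms(3)] by simp

lemma computable_comp3:
  assumes "computable e e1 f" "computable e e2 g" "computable e e3 k"
    "computable (enc_pair e1 (enc_pair e2 e3)) e4 (\<lambda>z. h (fst z) (fst (snd z)) (snd (snd z)))"
  shows "computable e e4 (\<lambda>x. h (f x) (g x) (k x))"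
  using computable_comp[OF computable_Pair[OF assms(1) computable_Pair[OF assms(2,3)]] assms(4)] by simp

lemma computable_fst:
  assumes "computable e (enc_pair e1 e2) f"
  shows "computable e e1 (\<lambda>x. fst (f x))"
  by (rule computable_comp[OF assms], rule computableI[of First]) (simp add: enc_pair_def)

lemma computable_snd:
  assumes "computable e (enc_pair e1 e2) f"
  shows "computable e e2 (\<lambda>x. snd (f x))"
  by (rule computable_comp[OF assms], rule computableI[of Second]) (simp add: enc_pair_def)

lemma computable_scalar_0: "computable e Scalar (\<lambda>x. 0)"
  by (rule computableI[of Zero]) simp

lemma computable_scalar_add:
  assumes "computable e Scalar f" "computable e Scalar g"
  shows "computable e Scalar (\<lambda>x. f x + g x)"
  by (rule computable_comp2[OF assms], rule computableI[of Add]) (simp add: enc_pair_def)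

lemma computable_scalar_mult:
  assumes "computable e Scalar f" "computable e Scalar g"
  shows "computable e Scalar (\<lambda>x. f x * g x)"
  by (rule computable_comp2[OF assms], rule computableI[of Mult]) (simp add: enc_pair_def)

lemma computable_scalar_uminus:
  assumes "computable e Scalar f"
  shows "computable e Scalar (\<lambda>x. - f x)"
  by (rule computable_comp[OF assms], rule computableI[of Minus]) simp

lemma computable_scalar_inverse:
  assumes "computable e Scalar f"
  shows "computable e Scalar (\<lambda>x. inverse (f x))"
  by (rule computable_comp[OF assms], rule computableI[of Inverse]) simp

lemma computable_sigma:
  assumes "computable e Scalar f"
  shows "computable e Scalar (\<lambda>x. \<sigma> (f x))"
  by (rule computable_comp[OF assms], rule computableI[of Sigma]) simp

lemma computable_delta:
  assumes "computable e Scalar f"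
  shows "computable e Scalar (\<lambda>x. \<delta> (f x))"
  by (rule computable_comp[OF assms], rule computableI[of Delta]) simp

lemma computable_If:
  assumes "computable e enc_bool b" "computable e e' f" "computable e e' g"
  shows "computable e e' (\<lambda>x. if b x then f x else g x)"
proof -
  obtain T P Q where "\<And>x. run \<sigma> \<delta> T (e x) = Some (enc_bool (b x))"
      "\<And>x. run \<sigma> \<delta> P (e x) = Some (e' (f x))" "\<And>x. run \<sigma> \<delta> Q (e x) = Some (e' (g x))"
    using assms unfolding computable_def by blast
  thus ?thesis by (intro computableI[of "IfNull T P Q"]) (simp add: enc_bool_def)
qed

lemma computable_Nil: "computable e (enc_list e1) (\<lambda>x. [])"
  by (rule computableI[of MkNull]) simp

text \<open>The encoded pair of head and tail is literally the encoded list, hence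
  \<open>Skip\<close>.\<close>

lemma computable_Cons:
  assumes "computable e e1 f" "computable e (enc_list e1) xs"
  shows "computable e (enc_list e1) (\<lambda>x. f x # xs x)"
  by (rule computable_comp2[OF assms], rule computableI[of Skip]) (simp add: enc_pair_def)

text \<open>\<open>Second\<close> fails on \<open>Null\<close>, so the empty list is caught first
  and returned as its own tail.\<close>

lemma computable_tl:
  assumes "computable e (enc_list e1) xs"
  shows "computable e (enc_list e1) (\<lambda>x. tl (xs x))"
proof (rule computable_comp[OF assms], rule computableI[of "IfNull Skip Skip Second"])
  show "run \<sigma> \<delta> (IfNull Skip Skip Second) (enc_list e1 ys) = Some (enc_list e1 (tl ys))" for ys
    by (cases ys) auto
qed

lemma computable_eq_Nil:
  assumes "computable e (enc_list e1) xs"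
  shows "computable e enc_bool (\<lambda>x. xs x = [])"
proof (rule computable_comp[OF assms], rule computableI[of "IfNull Skip MkNull (MkNode MkNull MkNull)"])
  show "run \<sigma> \<delta> (IfNull Skip MkNull (MkNode MkNull MkNull)) (enc_list e1 ys) = Some (enc_bool (ys = []))" for ys
    by (cases ys) (auto simp: enc_bool_def)
qed

section \<open>Loops along lists\<close>

lemma computable_foldl:
  assumes "computable e ea i" "computable e (enc_list el) xs"
    "computable (enc_pair e (enc_pair ea el)) ea (\<lambda>z. F (fst z) (fst (snd z)) (snd (snd z)))"
  shows "computable e ea (\<lambda>x. foldl (F x) (i x) (xs x))"
proof -
  obtain I L B where I: "\<And>x. run \<sigma> \<delta> I (e x) = Some (ea (i x))"
    and L: "\<And>x. run \<sigma> \<delta> L (e x) = Some (enc_list el (xs x))"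
    and B: "\<And>z. run \<sigma> \<delta> B (enc_pair e (enc_pair ea el) z) = Some (ea (F (fst z) (fst (snd z)) (snd (snd z))))"
    using assms unfolding computable_def by blast
  have B: "run \<sigma> \<delta> B (Node (e x) (Node (ea a) (el y))) = Some (ea (F x a y))" for x a y
    using B[of "(x, a, y)"] by (simp add: enc_pair_def)
  \<comment> \<open>The loop state consists of environment, accumulator and remaining list.
    \<open>T\<close> reads the remaining list; \<open>S\<close> updates the accumulator with the
    head and drops the head.\<close>
  define T where "T = Seq Second Second"
  define S where "S = MkNode First (MkNode
    (Seq (MkNode First (MkNode (Seq Second First) (Seq T First))) B) (Seq T Second))"
  \<comment> \<open>The loop is unfolded once per list element, so it terminates.\<close>
  have "while_not_null (run \<sigma> \<delta> T) (run \<sigma> \<delta> S) (Node (e x) (Node (ea a) (enc_list el ys))) =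
      Some (Node (e x) (Node (ea (foldl (F x) a ys)) Null))" for x a ys
    by (induction ys arbitrary: a; subst while_not_null.simps) (simp_all add: T_def S_def B)
  thus ?thesis
    by (intro computableI[of "Seq (MkNode Skip (MkNode I L)) (Seq (WhileNotNull T S) (Seq Second First))"])
      (simp add: I L)
qed

lemma foldl_Cons_eq_rev: "foldl (\<lambda>l x. x # l) ys xs = rev xs @ ys"
  by (induction xs arbitrary: ys) auto

lemma computable_rev:
  assumes "computable e (enc_list e1) xs"
  shows "computable e (enc_list e1) (\<lambda>x. rev (xs x))"
proof -
  have "computable e (enc_list e1) (\<lambda>x. foldl (\<lambda>l x. x # l) [] (xs x))"
    by (rule computable_foldl computable_Nil assms computable_Cons computable_fst computable_snd computable_id)+
  thus ?thesis by (simp add: foldl_Cons_eq_rev)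
qed

lemma computable_foldr:
  assumes "computable e ea i" "computable e (enc_list el) xs"
    "computable (enc_pair e (enc_pair el ea)) ea (\<lambda>z. F (fst z) (fst (snd z)) (snd (snd z)))"
  shows "computable e ea (\<lambda>x. foldr (F x) (xs x) (i x))"
proof -
  have "computable e ea (\<lambda>x. foldl (\<lambda>a y. F x y a) (i x) (rev (xs x)))"
    by (rule computable_foldl computable_rev computable_comp3[OF _ _ _ assms(3)] assms(1,2)
        computable_fst computable_snd computable_id)+
  thus ?thesis by (simp add: foldr_conv_foldl)
qed

lemma foldl_tl_eq_drop: "foldl (\<lambda>l _. tl l) ys xs = drop (length xs) ys"
  by (induction xs arbitrary: ys) (auto simp: drop_Suc)

text \<open>Lists act as unary counters: each element of \<open>xs\<close> removes one head of
  \<open>ys\<close>. Comparison and subtraction of lengths reduce to this.\<close>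

lemma computable_drop:
  assumes "computable e (enc_list e1) xs" "computable e (enc_list e2) ys"
  shows "computable e (enc_list e2) (\<lambda>x. drop (length (xs x)) (ys x))"
proof -
  have "computable e (enc_list e2) (\<lambda>x. foldl (\<lambda>l _. tl l) (ys x) (xs x))"
    by (rule computable_foldl assms computable_tl computable_fst computable_snd computable_id)+
  thus ?thesis by (simp add: foldl_tl_eq_drop)
qed

lemma computable_length_le:
  assumes "computable e (enc_list e1) xs" "computable e (enc_list e2) ys"
  shows "computable e enc_bool (\<lambda>x. length (xs x) \<le> length (ys x))"
  using computable_eq_Nil[OF computable_drop[OF assms(2,1)]] by simp

lemma foldl_eq_funpow: "foldl (\<lambda>a _. h a) a xs = (h ^^ length xs) a"
  by (induction xs arbitrary: a) (simp_all add: funpow_swap1)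

lemma computable_funpow:
  assumes "computable e ea i" "computable e (enc_list el) xs"
    "computable (enc_pair e ea) ea (\<lambda>z. F (fst z) (snd z))"
  shows "computable e ea (\<lambda>x. (F x ^^ length (xs x)) (i x))"
proof -
  have "computable e ea (\<lambda>x. foldl (\<lambda>a _. F x a) (i x) (xs x))"
    by (rule computable_foldl computable_comp2[OF _ _ assms(3)] assms(1,2)
        computable_fst computable_snd computable_id)+
  thus ?thesis by (simp add: foldl_eq_funpow)
qed

lemma computable_funpow_diff:
  assumes "computable e ea i" "computable e (enc_list e1) xs" "computable e (enc_list e2) ys"
    "computable (enc_pair e ea) ea (\<lambda>z. F (fst z) (snd z))"
  shows "computable e ea (\<lambda>x. (F x ^^ (length (xs x) - length (ys x))) (i x))"
  using computable_funpow[OF assms(1) computable_drop[OF assms(3,2)] assms(4)] by simp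

section \<open>Additive arithmetic of polynomials as coefficient lists\<close>

lemma computable_coeffs:
  assumes "computable e encode_poly p"
  shows "computable e (enc_list Scalar) (\<lambda>x. coeffs (p x))"
  by (rule computable_comp[OF assms], rule computableI[of Skip]) (simp add: encode_poly_coeffs)

lemma computable_poly_0: "computable e encode_poly (\<lambda>x. 0)"
  by (rule computableI[of MkNull]) (simp add: encode_poly_coeffs)

lemma computable_poly_eq_0:
  assumes "computable e encode_poly p"
  shows "computable e enc_bool (\<lambda>x. p x = 0)"
  using computable_eq_Nil[OF computable_coeffs[OF assms]] by simp

text \<open>Coefficient lists do not end in 0, so putting 0 in front of the zero polynomial must
  give \<open>Null\<close>. Otherwise the encoded pair is already the result.\<close>

lemma computable_pCons:
  assumes "computable e Scalar a" "computable e encode_poly p"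
  shows "computable e encode_poly (\<lambda>x. pCons (a x) (p x))"
proof (rule computable_comp2[OF assms],
    rule computableI[of "IfNull Second (IfNull (Seq First IsZero) MkNull Skip) Skip"])
  show "run \<sigma> \<delta> (IfNull Second (IfNull (Seq First IsZero) MkNull Skip) Skip) (enc_pair Scalar encode_poly z) =
      Some (encode_poly (pCons (fst z) (snd z)))" for z
    by (cases "coeffs (snd z)") (auto simp: enc_pair_def encode_poly_coeffs cCons_def)
qed

text \<open>Rebuilding the polynomial with \<open>pCons\<close> strips the zero top coefficients
  that \<open>F x\<close> may create.\<close>

lemma computable_map_poly:
  assumes "computable e encode_poly p" "computable (enc_pair e Scalar) Scalar (\<lambda>z. F (fst z) (snd z))"
  shows "computable e encode_poly (\<lambda>x. map_poly (F x) (p x))"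
proof -
  have "foldr (\<lambda>a. pCons (h a)) xs 0 = Poly (map h xs)" for h :: "'a \<Rightarrow> 'a" and xs
    by (induction xs) auto
  moreover have "computable e encode_poly (\<lambda>x. foldr (\<lambda>a q. pCons (F x a) q) (coeffs (p x)) 0)"
    by (rule computable_foldr computable_pCons computable_coeffs computable_poly_0
        computable_comp2[OF _ _ assms(2)] assms(1) computable_fst computable_snd computable_id)+
  ultimately show ?thesis by (simp add: map_poly_def)
qed

lemma computable_coeff_0:
  assumes "computable e encode_poly p"
  shows "computable e Scalar (\<lambda>x. coeff (p x) 0)"
proof (rule computable_comp[OF assms], rule computableI[of "IfNull Skip Zero First"])
  show "run \<sigma> \<delta> (IfNull Skip Zero First) (encode_poly q) = Some (Scalar (coeff q 0))" for q
    by (cases "coeffs q")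
      (auto simp: encode_poly_coeffs nth_default_def simp flip: nth_default_coeffs_eq)
qed

lemma computable_poly_shift:
  assumes "computable e encode_poly p"
  shows "computable e encode_poly (\<lambda>x. poly_shift 1 (p x))"
proof (rule computable_comp[OF assms], rule computableI[of "IfNull Skip Skip Second"])
  show "run \<sigma> \<delta> (IfNull Skip Skip Second) (encode_poly q) = Some (encode_poly (poly_shift 1 q))" for q
    by (cases "coeffs q") (auto simp: encode_poly_coeffs coeffs_shift_poly)
qed

text \<open>A fold that keeps the latest entry ends with the last one; its start value 0 is the
  answer for the zero polynomial.\<close>

lemma computable_lead_coeff:
  assumes "computable e encode_poly p"
  shows "computable e Scalar (\<lambda>x. lead_coeff (p x))"
proof -
  have *: "foldl (\<lambda>_ x. x) a xs = last (a # xs)" for a :: 'a and xs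
    by (induction xs arbitrary: a) auto
  have "foldl (\<lambda>_ x. x) 0 (coeffs q) = lead_coeff q" for q :: "'a poly"
    by (cases "q = 0") (auto simp: * last_coeffs_eq_coeff_degree)
  moreover have "computable e Scalar (\<lambda>x. foldl (\<lambda>_ x. x) 0 (coeffs (p x)))"
    by (rule computable_foldl computable_scalar_0 computable_coeffs assms computable_snd computable_id)+
  ultimately show ?thesis by simp
qed

text \<open>The coefficients of the first summand are added to the low coefficients of the second one
  from left to right; the sums collected in reverse order are then put in front of the
  unused high coefficients.\<close>

definition add_step :: "'a list \<times> 'a poly \<Rightarrow> 'a \<Rightarrow> 'a list \<times> 'a poly" where
  "add_step z a = ((a + coeff (snd z) 0) # fst z, poly_shift 1 (snd z))"

lemma computable_add_step:
  assumes "computable e (enc_pair (enc_list Scalar) encode_poly) z" "computable e Scalar a"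
  shows "computable e (enc_pair (enc_list Scalar) encode_poly) (\<lambda>x. add_step (z x) (a x))"
  unfolding add_step_def
  by (rule computable_Pair computable_Cons computable_scalar_add computable_coeff_0
      computable_poly_shift computable_fst computable_snd assms)+

text \<open>Each step moves the lowest coefficient of \<open>Poly xs + q\<close> onto the stack
  \<open>as\<close>; unloading the stack with \<open>pCons\<close> therefore gives the same
  polynomial before and after.\<close>

lemma foldl_add_step:
  "foldl (\<lambda>r x. pCons x r) (snd (foldl add_step (as, q) xs)) (fst (foldl add_step (as, q) xs)) =
   foldl (\<lambda>r x. pCons x r) (Poly xs + q) as"
proof (induction xs arbitrary: as q)
  case (Cons a xs)
  have "Poly (a # xs) + q = pCons (a + coeff q 0) (Poly xs + poly_shift 1 q)"
    by (auto simp: poly_eq_iff coeff_pCons coeff_poly_shift split: nat.split)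
  thus ?case by (simp add: Cons.IH add_step_def[of _ a])
qed simp

lemma computable_poly_add:
  assumes "computable e encode_poly p" "computable e encode_poly q"
  shows "computable e encode_poly (\<lambda>x. p x + q x)"
proof -
  have 1: "computable e (enc_pair (enc_list Scalar) encode_poly) (\<lambda>x. foldl add_step ([], q x) (coeffs (p x)))"
    by (rule computable_foldl computable_add_step computable_Pair computable_Nil assms computable_coeffs
        computable_fst computable_snd computable_id)+
  have "computable e encode_poly (\<lambda>x. foldl (\<lambda>r x. pCons x r)
      (snd (foldl add_step ([], q x) (coeffs (p x)))) (fst (foldl add_step ([], q x) (coeffs (p x)))))"
    by (rule computable_foldl computable_fst[OF 1] computable_snd[OF 1] computable_pCons
        computable_fst computable_snd computable_id)+
  thus ?thesis by (simp add: foldl_add_step)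
qed

lemmas computable_intros =
  computable_fst computable_snd computable_Pair computable_id computable_If computable_poly_eq_0
  computable_length_le computable_Nil computable_Cons computable_tl computable_coeffs computable_lead_coeff
  computable_scalar_mult computable_scalar_uminus computable_scalar_inverse computable_scalar_0
  computable_sigma computable_delta computable_poly_0 computable_pCons computable_map_poly computable_poly_add

section \<open>Programs for skew arithmetic, division and the splitting\<close>

lemma computable_X:
  assumes "computable e encode_poly p"
  shows "computable e encode_poly (\<lambda>x. X (p x))"
  unfolding X_mult_def by (rule computable_intros assms)+

text \<open>The body is treated only for the bare pair of its arguments;
  \<open>computable_comp2\<close> passes to a general environment. The algorithms below follow the
  same pattern.\<close>

lemma computable_scal:
  assumes "computable e Scalar c" "computable e encode_poly p"
  shows "computable e encode_poly (\<lambda>x. scal (c x) (p x))"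
proof -
  have "computable (enc_pair Scalar encode_poly) encode_poly (\<lambda>w. scal (fst w) (snd w))"
    unfolding scal_def
    by (rule computable_intros)+
  from computable_comp2[OF assms this] show ?thesis .
qed

text \<open>Turns the monomial of a division step into an iteration whose count is a difference of
  list lengths, the form \<open>computable_funpow_diff\<close> handles.\<close>

lemma funpow_pCons_0: "(pCons 0 ^^ k) [:c:] = monom c k"
  by (induction k) (simp_all add: monom_0 monom_Suc)

lemma computable_rdiv_step:
  assumes "computable e encode_poly g" "computable e (enc_pair encode_poly encode_poly) z"
  shows "computable e (enc_pair encode_poly encode_poly) (\<lambda>x. rdiv_step (g x) (z x))"
proof -
  have "computable (enc_pair encode_poly (enc_pair encode_poly encode_poly))
      (enc_pair encode_poly encode_poly) (\<lambda>w. rdiv_step (fst w) (snd w))"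
    unfolding rdiv_step_def Let_def funpow_pCons_0[symmetric]
    by (rule computable_intros computable_funpow_diff computable_X computable_scal)+
  from computable_comp2[OF assms this] show ?thesis .
qed

lemma computable_rdiv:
  assumes "computable e encode_poly f" "computable e encode_poly g"
  shows "computable e (enc_pair encode_poly encode_poly) (\<lambda>x. rdiv (f x) (g x))"
proof -
  have "computable (enc_pair encode_poly encode_poly)
      (enc_pair encode_poly encode_poly) (\<lambda>w. rdiv (fst w) (snd w))"
    unfolding rdiv_def
    by (rule computable_intros computable_funpow computable_rdiv_step)+
  from computable_comp2[OF assms this] show ?thesis .
qed

lemma computable_gcrd_step:
  assumes "computable e (enc_pair encode_poly encode_poly) z"
  shows "computable e (enc_pair encode_poly encode_poly) (\<lambda>x. gcrd_step (z x))"
proof -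
  have "computable (enc_pair encode_poly encode_poly) (enc_pair encode_poly encode_poly) (\<lambda>w. gcrd_step w)"
    unfolding gcrd_step_def
    by (rule computable_intros computable_rdiv)+
  from computable_comp[OF assms this] show ?thesis .
qed

lemma computable_gcrd:
  assumes "computable e encode_poly f" "computable e encode_poly p"
  shows "computable e encode_poly (\<lambda>x. gcrd (f x) (p x))"
proof -
  have "computable (enc_pair encode_poly encode_poly) encode_poly (\<lambda>w. gcrd (fst w) (snd w))"
    unfolding gcrd_def
    by (rule computable_intros computable_funpow computable_gcrd_step)+
  from computable_comp2[OF assms this] show ?thesis .
qed

lemma computable_split_step:
  assumes "computable e encode_poly \<pi>" "computable e (enc_pair encode_poly (enc_list encode_poly)) z"
  shows "computable e (enc_pair encode_poly (enc_list encode_poly)) (\<lambda>x. split_step (\<pi> x) (z x))"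
proof -
  have "computable (enc_pair encode_poly (enc_pair encode_poly (enc_list encode_poly)))
      (enc_pair encode_poly (enc_list encode_poly)) (\<lambda>w. split_step (fst w) (snd w))"
    unfolding split_step_def
    by (rule computable_intros computable_rdiv computable_gcrd)+
  from computable_comp2[OF assms this] show ?thesis .
qed

lemma computable_bound_factors:
  "computable (enc_pair encode_poly (enc_list encode_poly)) (enc_list encode_poly)
     (\<lambda>z. bound_factors (fst z) (snd z))"
proof -
  have *: "computable (enc_pair encode_poly (enc_list encode_poly)) (enc_pair encode_poly (enc_list encode_poly))
      (\<lambda>z. foldr split_step (tl (snd z)) (fst z, []))"
    by (rule computable_foldr computable_split_step computable_Pair computable_Nil computable_tl
        computable_fst computable_snd computable_id)+
  show ?thesis
    unfolding bound_factors_def Let_def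
    by (rule computable_Cons computable_fst[OF *] computable_snd[OF *])+
qed

end

theorem proposition5p2:
  fixes \<sigma> \<delta> :: "'a::division_ring \<Rightarrow> 'a"
  assumes "ring_automorphism \<sigma>" and "skew_derivation \<sigma> \<delta>"
  defines "R \<equiv> skew_poly_ring \<sigma> \<delta>"
  shows "\<exists>P. \<forall>f \<pi>s. bounded R f \<longrightarrow> \<pi>s \<noteq> [] \<longrightarrow>
           (\<forall>i < length \<pi>s. prime_twosided R (\<pi>s ! i)) \<longrightarrow> is_bound R f (list_prod R \<pi>s) \<longrightarrow>
           (\<exists>gs. run \<sigma> \<delta> P (Node (encode_poly f) (encode_polys \<pi>s)) = Some (encode_polys gs) \<and>
                 length gs = length \<pi>s \<and> f = list_prod R gs \<and>
                 (\<forall>i < length \<pi>s. is_bound R (gs ! i) (\<pi>s ! i)))"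
proof -
  interpret skew_polynomials \<sigma> \<delta> using assms(1,2) by unfold_locales
  \<comment> \<open>The program is fixed before \<open>f\<close> and \<open>\<pi>s\<close>, so one
    program serves all inputs.\<close>
  obtain P where P: "\<And>z. run \<sigma> \<delta> P (enc_pair encode_poly (enc_list encode_poly) z) =
      Some (enc_list encode_poly (bound_factors (fst z) (snd z)))"
    using computable_bound_factors unfolding computable_def by blast
  have "\<exists>gs. run \<sigma> \<delta> P (Node (encode_poly f) (encode_polys \<pi>s)) = Some (encode_polys gs) \<and>
          length gs = length \<pi>s \<and> f = list_prod R gs \<and> (\<forall>i < length \<pi>s. is_bound R (gs ! i) (\<pi>s ! i))"
    if "\<pi>s \<noteq> []" "\<forall>i < length \<pi>s. prime_twosided R (\<pi>s ! i)" "is_bound R f (list_prod R \<pi>s)" for f \<pi>s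
  proof (intro exI[of _ "bound_factors f \<pi>s"] conjI)
    show "run \<sigma> \<delta> P (Node (encode_poly f) (encode_polys \<pi>s)) = Some (encode_polys (bound_factors f \<pi>s))"
      using P[of "(f, \<pi>s)"] by (simp add: enc_pair_def enc_list_def encode_polys_def)
    have "\<forall>p \<in> set \<pi>s. prime_twosided R p" using that(2) by (auto simp: in_set_conv_nth)
    note bound_factors_correct[of f \<pi>s, folded R_def, OF that(3,1) this]
    thus "f = list_prod R (bound_factors f \<pi>s)" "length (bound_factors f \<pi>s) = length \<pi>s"
      "\<forall>i < length \<pi>s. is_bound R (bound_factors f \<pi>s ! i) (\<pi>s ! i)"
      by (auto simp: list_all2_conv_all_nth)
  qed
  thus ?thesis by blast
qed

end
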